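(* Let $X$ and $Y$ be compact Hausdorff spaces, and let $\operatorname{hAut}(X)$ and $\operatorname{hAut}(Y)$ be their respective groups of homotopy classes of self-homotopy equivalences. Let $m\colon X\xrightarrow{\sim}Y$ be a homotopy equivalence, and let $\phi\colon\operatorname{hAut}(X)\to\operatorname{hAut}(Y)$ be the induced group homomorphism. Then for every $n\ge 0$ the induced isomorphism of graded $S_n$-representations \[ H_*(\operatorname{Conf}_n(X)^+)\xrightarrow{\ \sim\ }H_*(\operatorname{Conf}_n(Y)^+) \] is $\operatorname{hAut}(X)$-equivariant, where $\operatorname{hAut}(X)$ acts on the right-hand side through $\phi$.
   Context: For a compact Hausdorff space $X$ and $n\ge 0$, $\operatorname{Conf}_n(X)=\{(x_1,\dots,x_n)\in X^n : x_i\ne x_j\text{ for all } i\neq j\}$ and $\operatorname{Conf}_n(X)^+$ is its one-point compactification, i.e. $X^n$ with the locus $\{x_i=x_j \text{ for some } i\ne j\}$ collapsed to a base point, with $S_n$ permuting labels. A continuous map $f\colon X\to Y$ of compact Hausdorff spaces induces, via $f^n\colon X^n\to Y^n$, a pointed $S_n$-equivariant map $\operatorname{Conf}_n(X)^+\to\operatorname{Conf}_n(Y)^+$, functorially in $f$, and homotopic maps induce homotopic maps; hence $\operatorname{hAut}(X)$ acts on $H_*(\operatorname{Conf}_n(X)^+)$. If $m'\colon Y\to X$ is a homotopy inverse of $m$, the induced homomorphism is $\phi([f])=[m f m']$. *)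

theory Defs
  imports "HOL-Analysis.Urysohn" "HOL-Homology.Homology" "HOL-Algebra.Sym_Groups" "HOL-Algebra.Bij"
begin

section \<open>Homotopy classes and the group of self-homotopy equivalences\<close>

abbreviation homotopic :: "'a topology \<Rightarrow> 'b topology \<Rightarrow> ('a \<Rightarrow> 'b) \<Rightarrow> ('a \<Rightarrow> 'b) \<Rightarrow> bool"
  where "homotopic X Y \<equiv> homotopic_with (\<lambda>_. True) X Y"

definition homotopy_inverse ::
    "'a topology \<Rightarrow> 'b topology \<Rightarrow> ('a \<Rightarrow> 'b) \<Rightarrow> ('b \<Rightarrow> 'a) \<Rightarrow> bool"
  where "homotopy_inverse X Y f g \<longleftrightarrow>
    continuous_map X Y f \<and> continuous_map Y X g \<and>
    homotopic X X (g \<circ> f) id \<and> homotopic Y Y (f \<circ> g) id"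

definition homotopy_equivalence :: "'a topology \<Rightarrow> 'b topology \<Rightarrow> ('a \<Rightarrow> 'b) \<Rightarrow> bool"
  where "homotopy_equivalence X Y f \<longleftrightarrow> (\<exists>g. homotopy_inverse X Y f g)"

text \<open>Functions that agree on \<open>topspace X\<close> are homotopic in the sense of
  \<^const>\<open>homotopic_with\<close>, so values outside the space do not affect homotopy classes.\<close>

definition homotopy_class :: "'a topology \<Rightarrow> 'b topology \<Rightarrow> ('a \<Rightarrow> 'b) \<Rightarrow> ('a \<Rightarrow> 'b) set"
  where "homotopy_class X Y f = {g. homotopic X Y f g}"

text \<open>The product is \<open>[f] [g] = [f \<circ> g]\<close>; the union runs over all choices of representatives,
  which all give the same class.\<close>

definition hAut :: "'a topology \<Rightarrow> ('a \<Rightarrow> 'a) set monoid"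
  where "hAut X =
    \<lparr>carrier = {homotopy_class X X f | f. homotopy_equivalence X X f},
     monoid.mult = (\<lambda>A B. \<Union>f\<in>A. \<Union>g\<in>B. homotopy_class X X (f \<circ> g)),
     one = homotopy_class X X id\<rparr>"

text \<open>The map \<open>[f] \<mapsto> [m \<circ> f \<circ> m']\<close>, where \<open>m'\<close> is a homotopy inverse of \<open>m: X \<rightarrow> Y\<close>.\<close>

definition hAut_map ::
    "'b topology \<Rightarrow> ('a \<Rightarrow> 'b) \<Rightarrow> ('b \<Rightarrow> 'a) \<Rightarrow> ('a \<Rightarrow> 'a) set \<Rightarrow> ('b \<Rightarrow> 'b) set"
  where "hAut_map Y m m' A = (\<Union>f\<in>A. homotopy_class Y Y (m \<circ> f \<circ> m'))"


section \<open>Configuration spaces and their one-point compactifications\<close>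

definition Conf :: "nat \<Rightarrow> 'a topology \<Rightarrow> (nat \<Rightarrow> 'a) topology"
  where "Conf n X = subtopology (product_topology (\<lambda>_. X) {1..n}) {x. inj_on x {1..n}}"

text \<open>The base point is \<^const>\<open>None\<close>. If \<open>Conf n X\<close> is already compact (for instance if
  \<open>n \<le> 1\<close> and \<open>X\<close> is compact), the base point is isolated, in accordance with collapsing the
  empty set to a disjoint base point.\<close>

definition Conf_plus :: "nat \<Rightarrow> 'a topology \<Rightarrow> (nat \<Rightarrow> 'a) option topology"
  where "Conf_plus n X = Alexandroff_compactification (Conf n X)"

text \<open>The pointed map induced by \<open>f\<^sup>n\<close>: a configuration whose image has a coincidence
  goes to the base point.\<close>

definition Conf_plus_map ::
    "nat \<Rightarrow> ('a \<Rightarrow> 'b) \<Rightarrow> (nat \<Rightarrow> 'a) option \<Rightarrow> (nat \<Rightarrow> 'b) option"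
  where "Conf_plus_map n f z =
    (case z of None \<Rightarrow> None
     | Some x \<Rightarrow> let y = (\<lambda>i\<in>{1..n}. f (x i)) in if inj_on y {1..n} then Some y else None)"

text \<open>The left action of the symmetric group, \<open>(\<sigma> \<cdot> x)\<^sub>i = x\<^bsub>\<sigma>\<^sup>-\<^sup>1(i)\<^esub>\<close>.\<close>

definition Conf_plus_perm :: "(nat \<Rightarrow> nat) \<Rightarrow> (nat \<Rightarrow> 'a) option \<Rightarrow> (nat \<Rightarrow> 'a) option"
  where "Conf_plus_perm \<sigma> = map_option (\<lambda>x. x \<circ> inv' \<sigma>)"


section \<open>Homology of the compactified configuration spaces\<close>

abbreviation Conf_homology ::
    "int \<Rightarrow> nat \<Rightarrow> 'a topology \<Rightarrow> (nat \<Rightarrow> 'a) option chain set monoid"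
  where "Conf_homology p n X \<equiv> homology_group p (Conf_plus n X)"

definition Conf_homology_map ::
    "int \<Rightarrow> nat \<Rightarrow> 'a topology \<Rightarrow> 'b topology \<Rightarrow> ('a \<Rightarrow> 'b) \<Rightarrow>
      (nat \<Rightarrow> 'a) option chain set \<Rightarrow>
      (nat \<Rightarrow> 'b) option chain set"
  where "Conf_homology_map p n X Y f =
    restrict (hom_induced p (Conf_plus n X) {} (Conf_plus n Y) {} (Conf_plus_map n f))
      (carrier (Conf_homology p n X))"

definition sym_rep ::
    "int \<Rightarrow> nat \<Rightarrow> 'a topology \<Rightarrow> (nat \<Rightarrow> nat) \<Rightarrow>
      (nat \<Rightarrow> 'a) option chain set \<Rightarrow>
      (nat \<Rightarrow> 'a) option chain set"
  where "sym_rep p n X \<sigma> =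
    restrict (hom_induced p (Conf_plus n X) {} (Conf_plus n X) {} (Conf_plus_perm \<sigma>))
      (carrier (Conf_homology p n X))"

text \<open>All representatives of a class \<open>A\<close> in \<^const>\<open>hAut\<close> induce the same map in homology, and
  \<open>A\<close> acts by this common map.\<close>

definition hAut_rep ::
    "int \<Rightarrow> nat \<Rightarrow> 'a topology \<Rightarrow> ('a \<Rightarrow> 'a) set \<Rightarrow>
      (nat \<Rightarrow> 'a) option chain set \<Rightarrow>
      (nat \<Rightarrow> 'a) option chain set"
  where "hAut_rep p n X A = the_elem (Conf_homology_map p n X X ` A)"

end

theory Submission
  imports Defs
begin

text \<open>
  Everything is formal once \<open>X \<mapsto> Conf\<^sub>n(X)\<^sup>+\<close> is known to be a homotopy functor on compact
  Hausdorff spaces, that is, once \<^const>\<open>Conf_plus_map\<close> is known to turn a homotopy \<open>h\<^sub>t\<close> into a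
  continuous family of maps. The obstacle is that \<open>h\<^sub>t\<^sup>n\<close> does not preserve configuration spaces:
  distinct points may collide at some times \<open>t\<close>. But \<open>Conf\<^sub>n(X)\<close> is open in the compact Hausdorff
  space \<open>X\<^sup>n\<close>, and collapsing its closed complement gives a continuous map \<open>q: X\<^sup>n \<rightarrow> Conf\<^sub>n(X)\<^sup>+\<close>.
  Since coinciding points stay together under every map, \<open>(t, x) \<mapsto> q (h\<^sub>t\<^sup>n x)\<close> is constant on the
  collapsed locus and descends along \<open>id \<times> q\<close>. The preimage of a closed set under the descended map
  is the image under \<open>id \<times> q\<close> of a closed subset of the compact space \<open>[0,1] \<times> X\<^sup>n\<close>, possibly
  together with \<open>[0,1] \<times> {None}\<close>; hence it is compact, and therefore closed. This is
  \<open>continuous_map_Alexandroff_compactification_family\<close>, which also yields the continuity of the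
  permutations of labels.

  Homology then becomes a homotopy invariant functor of \<open>X\<close>. So a class in \<^const>\<open>hAut\<close> acts by the
  map induced by any of its members, a homotopy equivalence \<open>m\<close> induces an isomorphism whose inverse
  is induced by \<open>m'\<close>, and permutations of labels commute with \<^const>\<open>Conf_plus_map\<close> already on
  points. The equivariance under \<open>hAut X\<close> is the homotopy \<open>(m \<circ> f \<circ> m') \<circ> m \<simeq> m \<circ> f\<close>, and the same
  cancellation of \<open>m' \<circ> m\<close> makes \<open>[f] \<mapsto> [m \<circ> f \<circ> m']\<close> multiplicative.
\<close>

section \<open>Maps between one-point compactifications of open subsets\<close>

definition collapse_outside :: "'a set \<Rightarrow> 'a \<Rightarrow> 'a option"
  where "collapse_outside U x = (if x \<in> U then Some x else None)"

text \<open>An open set around the base point is the complement of a compact subset \<open>C\<close> of \<open>U\<close>, whose preimage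
  is \<open>C\<close> itself, closed in all of \<open>K\<close> because \<open>K\<close> is Hausdorff. An open set away from the base
  point is its own preimage, open in \<open>K\<close> because \<open>U\<close> is.\<close>

lemma continuous_map_collapse_outside:
  assumes "Hausdorff_space K" and U: "openin K (topspace K \<inter> U)"
  shows "continuous_map K (Alexandroff_compactification (subtopology K U)) (collapse_outside U)"
  unfolding continuous_map_def
proof (intro conjI allI impI)
  show "collapse_outside U \<in> topspace K \<rightarrow> topspace (Alexandroff_compactification (subtopology K U))"
    by (auto simp: collapse_outside_def)
next
  fix W
  assume "openin (Alexandroff_compactification (subtopology K U)) W"
  then consider (open_part) V where "openin (subtopology K U) V" "W = Some ` V"
    | (cocompact) C where "compactin (subtopology K U) C" "W = insert None (Some ` (topspace (subtopology K U) - C))"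
    unfolding openin_Alexandroff_compactification by blast
  then show "openin K {x \<in> topspace K. collapse_outside U x \<in> W}"
  proof cases
    case open_part
    then have "V \<subseteq> topspace K \<inter> U"
      by (metis openin_subset topspace_subtopology)
    then have "{x \<in> topspace K. collapse_outside U x \<in> W} = V"
      using open_part(2) by (auto simp: collapse_outside_def split: if_splits)
    moreover have "openin K V"
      using open_part(1) U by (metis openin_trans_full subtopology_restrict)
    ultimately show ?thesis by simp
  next
    case cocompact
    then have "compactin K C" "C \<subseteq> U"
      by (auto simp: compactin_subtopology)
    then have "closedin K C"
      using assms compactin_imp_closedin by blast
    moreover have "{x \<in> topspace K. collapse_outside U x \<in> W} = topspace K - C"
      using cocompact(2) \<open>C \<subseteq> U\<close> by (auto simp: collapse_outside_def split: if_splits)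
    ultimately show ?thesis by auto
  qed
qed

lemma Hausdorff_space_Alexandroff_compactification_open_subset:
  assumes "compact_space K" and "Hausdorff_space K" and "openin K (topspace K \<inter> U)"
  shows "Hausdorff_space (Alexandroff_compactification (subtopology K U))"
proof -
  have "locally_compact_space (subtopology K (topspace K \<inter> U))"
    using assms by (blast intro: locally_compact_space_open_subset compact_imp_locally_compact_space)
  then have "locally_compact_space (subtopology K U)"
    by (metis subtopology_restrict)
  then show ?thesis
    using assms by (simp add: Hausdorff_space_Alexandroff_compactification Hausdorff_space_subtopology)
qed

text \<open>Parametrised descent to \<open>U\<^sup>+\<close> and \<open>V\<^sup>+\<close>: with \<open>T\<close> an interval it turns homotopies into
  homotopies, with \<open>T\<close> a point it gives the continuity of a single induced map. The preimage of a
  closed set is the union of two compact sets, one from the collapse and one over the base point,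
  and compact sets are closed in the Hausdorff space \<open>T \<times> U\<^sup>+\<close>.\<close>

lemma continuous_map_Alexandroff_compactification_family:
  assumes T: "compact_space T" "Hausdorff_space T"
    and K: "compact_space K" "Hausdorff_space K" "openin K (topspace K \<inter> U)"
    and L: "Hausdorff_space L" "openin L (topspace L \<inter> V)"
    and F: "continuous_map (prod_topology T K) L F"
    and outside: "\<And>t x. \<lbrakk>t \<in> topspace T; x \<in> topspace K; x \<notin> U\<rbrakk> \<Longrightarrow> F (t, x) \<notin> V"
  shows "continuous_map (prod_topology T (Alexandroff_compactification (subtopology K U)))
           (Alexandroff_compactification (subtopology L V))
           (\<lambda>(t, z). Option.bind z (\<lambda>x. collapse_outside V (F (t, x))))"
    (is "continuous_map (prod_topology T ?KU) ?LV ?H")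
  unfolding continuous_map_closedin
proof (intro conjI allI impI)
  have FL: "F (t, x) \<in> topspace L" if "t \<in> topspace T" "x \<in> topspace K" for t x
    using continuous_map_funspace[OF F] that by auto
  then show "?H \<in> topspace (prod_topology T ?KU) \<rightarrow> topspace ?LV"
    by (auto simp: collapse_outside_def)
  fix C
  assume C: "closedin ?LV C"
  define S where "S = {p \<in> topspace (prod_topology T K). collapse_outside V (F p) \<in> C}"
  let ?q = "\<lambda>p. (fst p, collapse_outside U (snd p))"
  have TK: "compact_space (prod_topology T K)"
    using T K by (simp add: compact_space_prod_topology)
  have Haus: "Hausdorff_space (prod_topology T ?KU)"
    using T K by (simp add: Hausdorff_space_prod_topology Hausdorff_space_Alexandroff_compactification_open_subset)
  have "continuous_map (prod_topology T K) ?LV (collapse_outside V \<circ> F)"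
    using F L by (blast intro: continuous_map_compose continuous_map_collapse_outside)
  then have "closedin (prod_topology T K) S"
    using C unfolding S_def continuous_map_closedin by auto
  then have "compactin (prod_topology T K) S"
    by (rule closedin_compact_space[OF TK])
  moreover have "continuous_map (prod_topology T K) (prod_topology T ?KU) ?q"
    using continuous_map_compose[OF continuous_map_snd continuous_map_collapse_outside[OF K(2,3)]]
    by (intro continuous_map_pairedI continuous_map_fst) (simp add: o_def)
  ultimately have moving: "compactin (prod_topology T ?KU) (?q ` S)"
    by (rule image_compactin)
  \<comment> \<open>If \<open>U\<close> is all of \<open>K\<close>, the collapse misses the base point, which is then isolated.\<close>
  have base: "compactin (prod_topology T ?KU) (topspace T \<times> {z. z = None \<and> None \<in> C})"
    using T by (simp add: compactin_Times compact_space_def finite_imp_compactin)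
  have "{p \<in> topspace (prod_topology T ?KU). ?H p \<in> C} = ?q ` S \<union> topspace T \<times> {z. z = None \<and> None \<in> C}"
  proof (intro equalityI subsetI)
    fix p
    assume "p \<in> {p \<in> topspace (prod_topology T ?KU). ?H p \<in> C}"
    then obtain t z where p: "p = (t, z)" "t \<in> topspace T" "z \<in> topspace ?KU" "?H (t, z) \<in> C"
      by auto
    show "p \<in> ?q ` S \<union> topspace T \<times> {z. z = None \<and> None \<in> C}"
    proof (cases z)
      case None
      then show ?thesis using p by auto
    next
      case (Some x)
      then have "(t, x) \<in> S"
        using p by (auto simp: S_def)
      moreover have "p = ?q (t, x)"
        using p Some by (auto simp: collapse_outside_def)
      ultimately show ?thesis by (intro UnI1 rev_image_eqI)
    qed
  next
    fix p
    assume "p \<in> ?q ` S \<union> topspace T \<times> {z. z = None \<and> None \<in> C}"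
    then show "p \<in> {p \<in> topspace (prod_topology T ?KU). ?H p \<in> C}"
    proof
      assume "p \<in> ?q ` S"
      then obtain t x where tx: "t \<in> topspace T" "x \<in> topspace K" "collapse_outside V (F (t, x)) \<in> C"
        and p: "p = (t, collapse_outside U x)"
        by (auto simp: S_def)
      show ?thesis
        using tx p outside[OF tx(1,2)] by (cases "x \<in> U") (simp_all add: collapse_outside_def)
    next
      assume "p \<in> topspace T \<times> {z. z = None \<and> None \<in> C}"
      then show ?thesis by auto
    qed
  qed
  then show "closedin (prod_topology T ?KU) {p \<in> topspace (prod_topology T ?KU). ?H p \<in> C}"
    using compactin_imp_closedin[OF Haus compactin_Un[OF moving base]] by simp
qed

section \<open>Continuity on compactified configuration spaces\<close>

abbreviation power_topology :: "nat \<Rightarrow> 'a topology \<Rightarrow> (nat \<Rightarrow> 'a) topology"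
  where "power_topology n X \<equiv> product_topology (\<lambda>_. X) {1..n}"

text \<open>The complement is a finite union of the loci \<open>x\<^sub>i = x\<^sub>j\<close>, closed because \<open>X\<close> is Hausdorff.\<close>

lemma openin_distinct_tuples:
  assumes "Hausdorff_space X"
  shows "openin (power_topology n X) (topspace (power_topology n X) \<inter> {x. inj_on x {1..n}})"
proof -
  let ?P = "power_topology n X"
  let ?D = "\<lambda>i j. {x \<in> topspace ?P. x i = x j}"
  have D: "closedin ?P (?D i j)" if "i \<in> {1..n}" "j \<in> {1..n}" for i j
    by (rule closedin_continuous_maps_eq[OF assms continuous_map_product_projection[OF that(1)]
          continuous_map_product_projection[OF that(2)]])
  have "closedin ?P (\<Union>j\<in>{1..n} - {i}. ?D i j)" if "i \<in> {1..n}" for i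
    using that D by (intro closedin_Union) (auto simp del: One_nat_def topspace_product_topology)
  then have "closedin ?P (\<Union>i\<in>{1..n}. \<Union>j\<in>{1..n} - {i}. ?D i j)"
    by (intro closedin_Union) (auto simp del: One_nat_def topspace_product_topology)
  then have "openin ?P (topspace ?P - (\<Union>i\<in>{1..n}. \<Union>j\<in>{1..n} - {i}. ?D i j))"
    by (rule openin_diff[OF openin_topspace])
  moreover have "topspace ?P \<inter> {x. inj_on x {1..n}}
      = topspace ?P - (\<Union>i\<in>{1..n}. \<Union>j\<in>{1..n} - {i}. ?D i j)"
    by (auto simp: inj_on_def simp del: One_nat_def topspace_product_topology)
  ultimately show ?thesis
    by (rule back_subst[of "openin ?P", OF _ sym])
qed

lemma Conf_plus_eq:
  "Conf_plus n X = Alexandroff_compactification (subtopology (power_topology n X) {x. inj_on x {1..n}})"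
  by (simp add: Conf_plus_def Conf_def)

lemma continuous_map_Conf_plus_family:
  assumes "compact_space T" "Hausdorff_space T" "compact_space X" "Hausdorff_space X" "Hausdorff_space Y"
    and "continuous_map (prod_topology T (power_topology n X)) (power_topology n Y) F"
    and "\<And>t x. \<lbrakk>t \<in> topspace T; inj_on (F (t, x)) {1..n}\<rbrakk> \<Longrightarrow> inj_on x {1..n}"
  shows "continuous_map (prod_topology T (Conf_plus n X)) (Conf_plus n Y)
    (\<lambda>(t, z). Option.bind z (\<lambda>x. collapse_outside {y. inj_on y {1..n}} (F (t, x))))"
  unfolding Conf_plus_eq using assms
  by (intro continuous_map_Alexandroff_compactification_family)
    (simp_all add: compact_space_product_topology Hausdorff_space_product_topology openin_distinct_tuples
      del: One_nat_def topspace_product_topology, blast)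

lemma Conf_plus_map_eq_collapse:
  "Conf_plus_map n f z =
    Option.bind z (\<lambda>x. collapse_outside {y. inj_on y {1..n}} (\<lambda>i\<in>{1..n}. f (x i)))"
  by (cases z) (simp_all add: Conf_plus_map_def collapse_outside_def Let_def)

lemma inj_on_if_inj_on_map_tuple:
  assumes "inj_on (\<lambda>i\<in>I. f (x i)) I"
  shows "inj_on x I"
proof (rule inj_onI)
  fix i j
  assume "i \<in> I" "j \<in> I" "x i = x j"
  then show "i = j" by (intro inj_onD[OF assms]) simp_all
qed

text \<open>A homotopy \<open>h\<close> from \<open>f\<close> to \<open>g\<close> gives the continuous family \<open>(t, x) \<mapsto> h\<^sub>t\<^sup>n x\<close>, to which the descent applies.\<close>

lemma homotopic_Conf_plus_map:
  assumes X: "compact_space X" "Hausdorff_space X" and Y: "Hausdorff_space Y"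
    and fg: "homotopic X Y f g"
  shows "homotopic (Conf_plus n X) (Conf_plus n Y) (Conf_plus_map n f) (Conf_plus_map n g)"
proof -
  let ?I = "top_of_set {0..1::real}"
  obtain h where h: "continuous_map (prod_topology ?I X) Y h"
    and h0: "\<And>x. h (0, x) = f x" and h1: "\<And>x. h (1, x) = g x"
    using fg unfolding homotopic_with_def by blast
  define F where "F = (\<lambda>(t, x). \<lambda>i\<in>{1..n}. h (t, x i))"
  have coord: "continuous_map (prod_topology ?I (power_topology n X)) Y (\<lambda>p. h (fst p, snd p i))"
    if "i \<in> {1..n}" for i
  proof -
    have "continuous_map (prod_topology ?I (power_topology n X)) X (\<lambda>p. snd p i)"
      using continuous_map_compose[OF continuous_map_snd continuous_map_product_projection[OF that]]
      by (simp add: o_def)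
    then have "continuous_map (prod_topology ?I (power_topology n X)) (prod_topology ?I X) (\<lambda>p. (fst p, snd p i))"
      by (intro continuous_map_pairedI continuous_map_fst)
    from continuous_map_compose[OF this h] show ?thesis by (simp add: o_def)
  qed
  have "continuous_map (prod_topology ?I (power_topology n X)) (power_topology n Y) F"
    using coord unfolding continuous_map_componentwise by (auto simp: F_def case_prod_unfold)
  moreover have "inj_on x {1..n}" if "inj_on (F (t, x)) {1..n}" for t x
    using that inj_on_if_inj_on_map_tuple[of "\<lambda>a. h (t, a)" x "{1..n}"] by (simp add: F_def)
  ultimately have "continuous_map (prod_topology ?I (Conf_plus n X)) (Conf_plus n Y)
      (\<lambda>(t, z). Option.bind z (\<lambda>x. collapse_outside {y. inj_on y {1..n}} (F (t, x))))"
    using X Y by (intro continuous_map_Conf_plus_family)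
      (auto simp: compact_space_subtopology Hausdorff_space_subtopology)
  then show ?thesis
    unfolding homotopic_with_def
    by (intro exI conjI) (auto simp: F_def h0 h1 Conf_plus_map_eq_collapse)
qed

lemma continuous_map_Conf_plus_map:
  assumes "compact_space X" "Hausdorff_space X" "Hausdorff_space Y" "continuous_map X Y f"
  shows "continuous_map (Conf_plus n X) (Conf_plus n Y) (Conf_plus_map n f)"
  using homotopic_Conf_plus_map[of X Y f f n] assms by simp

text \<open>A configuration sent to the base point by \<open>f\<close> has a coincidence in its image, hence also
  one after applying \<open>g\<close>.\<close>

lemma Conf_plus_map_compose: "Conf_plus_map n (g \<circ> f) = Conf_plus_map n g \<circ> Conf_plus_map n f"
proof
  fix z
  show "Conf_plus_map n (g \<circ> f) z = (Conf_plus_map n g \<circ> Conf_plus_map n f) z"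
  proof (cases z)
    case (Some x)
    have comp: "(\<lambda>i\<in>{1..n}. g ((\<lambda>i\<in>{1..n}. f (x i)) i)) = (\<lambda>i\<in>{1..n}. g (f (x i)))"
      by auto
    then have "inj_on (\<lambda>i\<in>{1..n}. f (x i)) {1..n}" if "inj_on (\<lambda>i\<in>{1..n}. g (f (x i))) {1..n}"
      using inj_on_if_inj_on_map_tuple[of g "\<lambda>i\<in>{1..n}. f (x i)"] that by metis
    then show ?thesis
      using Some comp by (simp add: Conf_plus_map_def Let_def split del: if_split cong: if_cong) auto
  qed (simp add: Conf_plus_map_def)
qed

lemma Conf_plus_map_id:
  assumes "z \<in> topspace (Conf_plus n X)"
  shows "Conf_plus_map n id z = z"
proof (cases z)
  case (Some x)
  then have "inj_on x {1..n}" "x \<in> extensional {1..n}"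
    using assms by (auto simp: Conf_plus_eq PiE_def)
  then show ?thesis
    using Some by (simp add: Conf_plus_map_def extensional_restrict Let_def)
qed (simp add: Conf_plus_map_def)

lemma Conf_plus_perm_compose:
  assumes "\<sigma> permutes S" "\<tau> permutes S"
  shows "Conf_plus_perm (\<sigma> \<circ> \<tau>) = Conf_plus_perm \<sigma> \<circ> Conf_plus_perm \<tau>"
proof -
  have "inv' (\<sigma> \<circ> \<tau>) = inv' \<tau> \<circ> inv' \<sigma>"
    using assms by (simp add: o_inv_distrib permutes_bij)
  then show ?thesis
    by (simp add: fun_eq_iff Conf_plus_perm_def option.map_comp o_assoc comp_def)
qed

lemma Conf_plus_perm_id: "Conf_plus_perm id = id"
  by (simp add: fun_eq_iff Conf_plus_perm_def option.map_ident)

lemma inj_on_o_permutes_inv: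
  assumes "\<sigma> permutes S"
  shows "inj_on (x \<circ> inv' \<sigma>) S \<longleftrightarrow> inj_on x S"
  using permutes_inv[OF assms]
  by (metis comp_inj_on_iff permutes_image permutes_inj_on)

lemma Conf_plus_perm_collapse:
  assumes "\<sigma> permutes S"
  shows "Conf_plus_perm \<sigma> (collapse_outside {y. inj_on y S} y)
    = collapse_outside {y. inj_on y S} (y \<circ> inv' \<sigma>)"
  by (simp add: collapse_outside_def Conf_plus_perm_def inj_on_o_permutes_inv[OF assms])

lemma Conf_plus_map_perm:
  assumes \<sigma>: "\<sigma> permutes {1..n}"
  shows "Conf_plus_map n f \<circ> Conf_plus_perm \<sigma> = Conf_plus_perm \<sigma> \<circ> Conf_plus_map n f"
proof
  fix z
  show "(Conf_plus_map n f \<circ> Conf_plus_perm \<sigma>) z = (Conf_plus_perm \<sigma> \<circ> Conf_plus_map n f) z"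
  proof (cases z)
    case (Some x)
    have "inv' \<sigma> i \<in> {1..n} \<longleftrightarrow> i \<in> {1..n}" for i
      using permutes_inv[OF \<sigma>] by (rule permutes_in_image)
    then have "(\<lambda>i\<in>{1..n}. f ((x \<circ> inv' \<sigma>) i)) = (\<lambda>i\<in>{1..n}. f (x i)) \<circ> inv' \<sigma>"
      by (simp add: fun_eq_iff)
    then have "Conf_plus_map n f (Conf_plus_perm \<sigma> z)
        = collapse_outside {y. inj_on y {1..n}} ((\<lambda>i\<in>{1..n}. f (x i)) \<circ> inv' \<sigma>)"
      by (simp only: Some Conf_plus_map_eq_collapse Conf_plus_perm_def option.map Option.bind.simps)
    also have "\<dots> = Conf_plus_perm \<sigma> (Conf_plus_map n f z)"
      by (simp only: Some Conf_plus_map_eq_collapse Conf_plus_perm_collapse[OF \<sigma>] Option.bind.simps)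
    finally show ?thesis by simp
  qed (simp add: Conf_plus_map_def Conf_plus_perm_def)
qed

lemma continuous_map_Conf_plus_perm:
  assumes X: "compact_space X" "Hausdorff_space X" and \<sigma>: "\<sigma> permutes {1..n}"
  shows "continuous_map (Conf_plus n X) (Conf_plus n X) (Conf_plus_perm \<sigma>)"
proof -
  \<comment> \<open>a constant family, over a one-point space of parameters\<close>
  let ?T = "discrete_topology {()}" and ?P = "power_topology n X"
  define F where "F = (\<lambda>(t :: unit, x :: nat \<Rightarrow> 'a). x \<circ> inv' \<sigma>)"
  have inv_mem: "inv' \<sigma> i \<in> {1..n} \<longleftrightarrow> i \<in> {1..n}" for i
    using permutes_inv[OF \<sigma>] by (rule permutes_in_image)
  have "continuous_map (prod_topology ?T ?P) X (\<lambda>p. snd p (inv' \<sigma> i))" if "i \<in> {1..n}" for i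
    using continuous_map_compose[OF continuous_map_snd continuous_map_product_projection, of "inv' \<sigma> i" "{1..n}" ?T "\<lambda>_. X"]
      that inv_mem by (simp add: o_def)
  moreover have "F \<in> topspace (prod_topology ?T ?P) \<rightarrow> extensional {1..n}"
    using inv_mem by (auto simp: F_def extensional_def PiE_def simp del: One_nat_def atLeastAtMost_iff)
  ultimately have "continuous_map (prod_topology ?T ?P) ?P F"
    unfolding continuous_map_componentwise by (auto simp: F_def case_prod_unfold)
  then have "continuous_map (prod_topology ?T (Conf_plus n X)) (Conf_plus n X)
      (\<lambda>(t, z). Option.bind z (\<lambda>x. collapse_outside {y. inj_on y {1..n}} (F (t, x))))"
    using X by (intro continuous_map_Conf_plus_family)
      (simp_all add: F_def inj_on_o_permutes_inv[OF \<sigma>, unfolded o_def] inj_on_o_permutes_inv[OF \<sigma>] compact_space_discrete_topology del: One_nat_def)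
  moreover have "continuous_map (Conf_plus n X) (prod_topology ?T (Conf_plus n X)) (\<lambda>z. ((), z))"
    by (simp add: continuous_map_pairwise o_def)
  ultimately have "continuous_map (Conf_plus n X) (Conf_plus n X)
      ((\<lambda>(t, z). Option.bind z (\<lambda>x. collapse_outside {y. inj_on y {1..n}} (F (t, x)))) \<circ> (\<lambda>z. ((), z)))"
    by (rule continuous_map_compose[rotated])
  then show ?thesis
    by (rule continuous_map_eq)
      (auto simp: F_def Conf_plus_eq Conf_plus_perm_def collapse_outside_def inj_on_o_permutes_inv[OF \<sigma>]
        simp del: One_nat_def)
qed

section \<open>The group of self-homotopy equivalences\<close>

lemma homotopic_compose:
  assumes "homotopic X Y f f'" "homotopic Y Z g g'"
  shows "homotopic X Z (g \<circ> f) (g' \<circ> f')"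
proof (rule homotopic_with_trans)
  show "homotopic X Z (g \<circ> f) (g \<circ> f')"
    using assms homotopic_with_imp_continuous_maps[OF assms(2)]
    by (blast intro: homotopic_with_compose_continuous_map_left)
  show "homotopic X Z (g \<circ> f') (g' \<circ> f')"
    using assms homotopic_with_imp_continuous_maps[OF assms(1)]
    by (blast intro: homotopic_with_compose_continuous_map_right)
qed

text \<open>The cancellation behind composition of homotopy equivalences, the multiplicativity of
  \<^const>\<open>hAut_map\<close> and the equivariance.\<close>

lemma homotopic_cancel:
  assumes "homotopic Y Y (g' \<circ> g) id" "continuous_map X Y f" "continuous_map Y Z h"
  shows "homotopic X Z (h \<circ> g' \<circ> g \<circ> f) (h \<circ> f)"
proof -
  have "homotopic X Z (h \<circ> ((g' \<circ> g) \<circ> f)) (h \<circ> (id \<circ> f))"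
    using assms by (intro homotopic_compose) auto
  then show ?thesis by (simp add: o_assoc)
qed

lemma homotopy_inverse_sym: "homotopy_inverse X Y f g \<Longrightarrow> homotopy_inverse Y X g f"
  by (simp add: homotopy_inverse_def)

lemma homotopy_inverse_compose:
  assumes f: "homotopy_inverse X Y f f'" and g: "homotopy_inverse Y Z g g'"
  shows "homotopy_inverse X Z (g \<circ> f) (f' \<circ> g')"
proof -
  have "homotopic X X (f' \<circ> g' \<circ> g \<circ> f) (f' \<circ> f)"
    using f g by (intro homotopic_cancel) (auto simp: homotopy_inverse_def)
  moreover have "homotopic Z Z (g \<circ> f \<circ> f' \<circ> g') (g \<circ> g')"
    using f g by (intro homotopic_cancel) (auto simp: homotopy_inverse_def)
  ultimately show ?thesis
    using f g unfolding homotopy_inverse_def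
    by (auto simp: o_assoc intro: continuous_map_compose homotopic_with_trans)
qed

lemma homotopy_class_eqI: "homotopic X Y f g \<Longrightarrow> homotopy_class X Y f = homotopy_class X Y g"
  unfolding homotopy_class_def by (blast intro: homotopic_with_trans homotopic_with_symD)

lemma hAut_map_class:
  assumes f: "continuous_map X X f" and m: "continuous_map X Y m" "continuous_map Y X m'"
  shows "hAut_map Y m m' (homotopy_class X X f) = homotopy_class Y Y (m \<circ> f \<circ> m')"
proof -
  have "homotopy_class Y Y (m \<circ> g \<circ> m') = homotopy_class Y Y (m \<circ> f \<circ> m')"
    if "g \<in> homotopy_class X X f" for g
    using that m by (intro homotopy_class_eqI homotopic_compose)
      (auto simp: homotopy_class_def homotopic_with_sym)
  moreover have "f \<in> homotopy_class X X f"
    using f by (simp add: homotopy_class_def)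
  ultimately show ?thesis
    unfolding hAut_map_def by blast
qed

lemma hAut_mult_class:
  assumes "continuous_map X X f" "continuous_map X X g"
  shows "homotopy_class X X f \<otimes>\<^bsub>hAut X\<^esub> homotopy_class X X g = homotopy_class X X (f \<circ> g)"
proof -
  have "homotopy_class X X (f' \<circ> g') = homotopy_class X X (f \<circ> g)"
    if "f' \<in> homotopy_class X X f" "g' \<in> homotopy_class X X g" for f' g'
    using that by (intro homotopy_class_eqI homotopic_compose)
      (auto simp: homotopy_class_def homotopic_with_sym)
  then have "homotopy_class X X f \<otimes>\<^bsub>hAut X\<^esub> homotopy_class X X g
      = (\<Union>f'\<in>homotopy_class X X f. \<Union>g'\<in>homotopy_class X X g. homotopy_class X X (f \<circ> g))"
    by (simp add: hAut_def)
  moreover have "f \<in> homotopy_class X X f" "g \<in> homotopy_class X X g"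
    using assms by (simp_all add: homotopy_class_def)
  ultimately show ?thesis by blast
qed

lemma hAut_carrierE:
  assumes "A \<in> carrier (hAut X)"
  obtains f f' where "A = homotopy_class X X f" "homotopy_inverse X X f f'"
    "continuous_map X X f" "continuous_map X X f'"
  using assms by (auto simp: hAut_def homotopy_equivalence_def homotopy_inverse_def)

lemma hAut_carrierI: "homotopy_inverse X X f f' \<Longrightarrow> homotopy_class X X f \<in> carrier (hAut X)"
  by (auto simp: hAut_def homotopy_equivalence_def)

lemma hAut_one: "\<one>\<^bsub>hAut X\<^esub> = homotopy_class X X id"
  by (simp add: hAut_def)

lemma homotopy_inverse_id: "homotopy_inverse X X id id"
  by (simp add: homotopy_inverse_def)

lemma group_hAut: "group (hAut X)"
proof (rule groupI)
  show "\<one>\<^bsub>hAut X\<^esub> \<in> carrier (hAut X)"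
    unfolding hAut_one using homotopy_inverse_id by (rule hAut_carrierI)
next
  fix A B assume "A \<in> carrier (hAut X)" "B \<in> carrier (hAut X)"
  then show "A \<otimes>\<^bsub>hAut X\<^esub> B \<in> carrier (hAut X)"
    by (elim hAut_carrierE) (auto simp: hAut_mult_class intro: hAut_carrierI homotopy_inverse_compose)
next
  fix A B C assume "A \<in> carrier (hAut X)" "B \<in> carrier (hAut X)" "C \<in> carrier (hAut X)"
  then show "A \<otimes>\<^bsub>hAut X\<^esub> B \<otimes>\<^bsub>hAut X\<^esub> C = A \<otimes>\<^bsub>hAut X\<^esub> (B \<otimes>\<^bsub>hAut X\<^esub> C)"
    by (elim hAut_carrierE) (simp add: hAut_mult_class continuous_map_compose o_assoc)
next
  fix A assume "A \<in> carrier (hAut X)"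
  then show "\<one>\<^bsub>hAut X\<^esub> \<otimes>\<^bsub>hAut X\<^esub> A = A"
    by (elim hAut_carrierE) (simp add: hAut_one hAut_mult_class)
next
  fix A assume "A \<in> carrier (hAut X)"
  then obtain f f' where f: "A = homotopy_class X X f" "homotopy_inverse X X f f'"
      "continuous_map X X f" "continuous_map X X f'"
    by (rule hAut_carrierE)
  then have "homotopy_class X X f' \<otimes>\<^bsub>hAut X\<^esub> A = \<one>\<^bsub>hAut X\<^esub>"
    by (auto simp: hAut_mult_class hAut_one homotopy_inverse_def intro!: homotopy_class_eqI)
  moreover have "homotopy_class X X f' \<in> carrier (hAut X)"
    using f(2) by (blast intro: hAut_carrierI homotopy_inverse_sym)
  ultimately show "\<exists>B\<in>carrier (hAut X). B \<otimes>\<^bsub>hAut X\<^esub> A = \<one>\<^bsub>hAut X\<^esub>"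
    by blast
qed

lemma group_hom_hAut_map:
  assumes m: "homotopy_inverse X Y m m'"
  shows "group_hom (hAut X) (hAut Y) (hAut_map Y m m')"
proof (intro group_hom.intro group_hom_axioms.intro group_hAut homI)
  have mc: "continuous_map X Y m" "continuous_map Y X m'"
    using m by (auto simp: homotopy_inverse_def)
  show "hAut_map Y m m' A \<in> carrier (hAut Y)" if "A \<in> carrier (hAut X)" for A
    using that
  proof (rule hAut_carrierE)
    fix f f' assume f: "A = homotopy_class X X f" "homotopy_inverse X X f f'" "continuous_map X X f"
    have "homotopy_inverse Y Y (m \<circ> (f \<circ> m')) ((m \<circ> f') \<circ> m')"
      by (rule homotopy_inverse_compose[OF homotopy_inverse_compose[OF homotopy_inverse_sym[OF m] f(2)] m])
    then show ?thesis
      using f mc by (auto simp: hAut_map_class o_assoc intro: hAut_carrierI)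
  qed
  fix A B assume "A \<in> carrier (hAut X)" "B \<in> carrier (hAut X)"
  then obtain f g where f: "A = homotopy_class X X f" "continuous_map X X f"
    and g: "B = homotopy_class X X g" "continuous_map X X g"
    by (metis hAut_carrierE)
  have "homotopic Y Y ((m \<circ> f) \<circ> m' \<circ> m \<circ> (g \<circ> m')) ((m \<circ> f) \<circ> (g \<circ> m'))"
    using m mc f g by (intro homotopic_cancel) (auto simp: homotopy_inverse_def intro: continuous_map_compose)
  then have "homotopy_class Y Y ((m \<circ> f \<circ> m') \<circ> (m \<circ> g \<circ> m')) = homotopy_class Y Y (m \<circ> (f \<circ> g) \<circ> m')"
    by (intro homotopy_class_eqI) (simp add: o_assoc)
  then show "hAut_map Y m m' (A \<otimes>\<^bsub>hAut X\<^esub> B) = hAut_map Y m m' A \<otimes>\<^bsub>hAut Y\<^esub> hAut_map Y m m' B"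
    using f g mc by (simp add: hAut_mult_class hAut_map_class continuous_map_compose)
qed

section \<open>Group actions by automorphisms\<close>

text \<open>A multiplicative and unital family of endomorphisms consists of bijections, since \<open>\<rho> (inv g)\<close> is
  inverse to \<open>\<rho> g\<close>. Extensionality is demanded because \<^const>\<open>AutoGroup\<close> consists of extensional
  functions.\<close>

lemma group_hom_AutoGroupI:
  assumes G: "group G" and C: "group C"
    and hom: "\<And>g. g \<in> carrier G \<Longrightarrow> \<rho> g \<in> hom C C"
    and ext: "\<And>g. g \<in> carrier G \<Longrightarrow> \<rho> g \<in> extensional (carrier C)"
    and one: "\<rho> \<one>\<^bsub>G\<^esub> = (\<lambda>x\<in>carrier C. x)"
    and mult: "\<And>g h. \<lbrakk>g \<in> carrier G; h \<in> carrier G\<rbrakk>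
      \<Longrightarrow> \<rho> (g \<otimes>\<^bsub>G\<^esub> h) = compose (carrier C) (\<rho> g) (\<rho> h)"
  shows "group_hom G (AutoGroup C) \<rho>"
proof -
  interpret G: group G by (rule G)
  have cancel: "\<rho> g (\<rho> h x) = x"
    if "g \<in> carrier G" "h \<in> carrier G" "g \<otimes>\<^bsub>G\<^esub> h = \<one>\<^bsub>G\<^esub>" "x \<in> carrier C" for g h x
    using mult[OF that(1,2)] one that(3,4) by (metis compose_eq restrict_apply')
  have auto: "\<rho> g \<in> auto C" if g: "g \<in> carrier G" for g
  proof -
    have "bij_betw (\<rho> g) (carrier C) (carrier C)"
      using g hom[OF g] hom[OF G.inv_closed[OF g]]
      by (intro bij_betw_byWitness[where f' = "\<rho> (inv\<^bsub>G\<^esub> g)"]) (auto simp: cancel hom_def)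
    then show ?thesis
      using g by (simp add: auto_def Bij_def hom ext)
  qed
  have Bij: "\<rho> g \<in> Bij (carrier C)" if "g \<in> carrier G" for g
    using auto[OF that] by (simp add: auto_def)
  show ?thesis
    using auto Bij
    by (intro group_hom.intro group_hom_axioms.intro G group.AutoGroup[OF C] homI)
      (simp_all add: AutoGroup_def BijGroup_def mult)
qed

section \<open>The induced maps in homology\<close>

lemma hom_induced_mem: "c \<in> carrier (homology_group p X) \<Longrightarrow>
    hom_induced p X {} Y {} f c \<in> carrier (homology_group p Y)"
  by (simp add: hom_induced_carrier)

lemma restrict_hom_induced_compose:
  assumes "continuous_map X Y f" "continuous_map Y Z g"
  shows "restrict (hom_induced p X {} Z {} (g \<circ> f)) (carrier (homology_group p X))
    = compose (carrier (homology_group p X))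
        (restrict (hom_induced p Y {} Z {} g) (carrier (homology_group p Y)))
        (restrict (hom_induced p X {} Y {} f) (carrier (homology_group p X)))"
  by (auto simp: fun_eq_iff compose_def hom_induced_compose_empty[OF assms] hom_induced_mem)

lemma restrict_hom_induced_hom:
  "restrict (hom_induced p X {} Y {} f) (carrier (homology_group p X))
    \<in> hom (homology_group p X) (homology_group p Y)"
proof -
  have "group (homology_group p X)" by simp
  then show ?thesis
    using hom_induced_empty_hom[of p X Y f]
    by (auto simp: hom_def group.is_monoid monoid.m_closed)
qed

lemma restrict_hom_induced_id:
  "restrict (hom_induced p X {} X {} id) (carrier (homology_group p X))
    = (\<lambda>c\<in>carrier (homology_group p X). c)"
  by (auto simp: fun_eq_iff hom_induced_id)

lemma Conf_homology_map_hom: "Conf_homology_map p n X Y f \<in> hom (Conf_homology p n X) (Conf_homology p n Y)"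
  unfolding Conf_homology_map_def by (rule restrict_hom_induced_hom)

lemma Conf_homology_map_mem: "c \<in> carrier (Conf_homology p n X) \<Longrightarrow>
    Conf_homology_map p n X Y f c \<in> carrier (Conf_homology p n Y)"
  using Conf_homology_map_hom[of p n X Y f] by (auto simp: hom_def)

lemma Conf_homology_map_homotopic:
  assumes "compact_space X" "Hausdorff_space X" "Hausdorff_space Y" "homotopic X Y f g"
  shows "Conf_homology_map p n X Y f = Conf_homology_map p n X Y g"
  unfolding Conf_homology_map_def
  using homology_homotopy_empty[OF homotopic_Conf_plus_map[OF assms]] by simp

lemma Conf_homology_map_compose:
  assumes "compact_space X" "Hausdorff_space X" "compact_space Y" "Hausdorff_space Y" "Hausdorff_space Z"
    and "continuous_map X Y f" "continuous_map Y Z g"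
  shows "Conf_homology_map p n X Z (g \<circ> f)
    = compose (carrier (Conf_homology p n X)) (Conf_homology_map p n Y Z g) (Conf_homology_map p n X Y f)"
  unfolding Conf_homology_map_def Conf_plus_map_compose
  using assms by (intro restrict_hom_induced_compose continuous_map_Conf_plus_map)

lemma Conf_homology_map_compose_apply:
  assumes "compact_space X" "Hausdorff_space X" "compact_space Y" "Hausdorff_space Y" "Hausdorff_space Z"
    and "continuous_map X Y f" "continuous_map Y Z g" and "c \<in> carrier (Conf_homology p n X)"
  shows "Conf_homology_map p n Y Z g (Conf_homology_map p n X Y f c) = Conf_homology_map p n X Z (g \<circ> f) c"
  using Conf_homology_map_compose[OF assms(1-7)] assms(8) by (simp add: compose_eq)

lemma Conf_homology_map_id:
  "Conf_homology_map p n X X id = (\<lambda>c\<in>carrier (Conf_homology p n X). c)"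
  using hom_induced_eq[of "Conf_plus n X" "Conf_plus_map n id" id p "{}" "Conf_plus n X" "{}"]
    restrict_hom_induced_id[of p "Conf_plus n X"]
  by (simp add: Conf_homology_map_def Conf_plus_map_id)

lemma group_hom_sym_rep:
  assumes X: "compact_space X" "Hausdorff_space X"
  shows "group_hom (sym_group n) (AutoGroup (Conf_homology p n X)) (sym_rep p n X)"
proof (rule group_hom_AutoGroupI)
  show "sym_rep p n X \<one>\<^bsub>sym_group n\<^esub> = (\<lambda>c\<in>carrier (Conf_homology p n X). c)"
    by (simp add: sym_rep_def sym_group_one Conf_plus_perm_id restrict_hom_induced_id)
  show "sym_rep p n X (\<sigma> \<otimes>\<^bsub>sym_group n\<^esub> \<tau>)
      = compose (carrier (Conf_homology p n X)) (sym_rep p n X \<sigma>) (sym_rep p n X \<tau>)"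
    if "\<sigma> \<in> carrier (sym_group n)" "\<tau> \<in> carrier (sym_group n)" for \<sigma> \<tau>
    using that X restrict_hom_induced_compose[OF continuous_map_Conf_plus_perm continuous_map_Conf_plus_perm]
    by (simp add: sym_rep_def sym_group_mult sym_group_carrier Conf_plus_perm_compose)
qed (simp_all add: sym_group_is_group sym_rep_def restrict_hom_induced_hom)

text \<open>Homotopy invariance makes the set of induced maps a singleton, so that its
  \<^const>\<open>the_elem\<close> is meaningful.\<close>

lemma hAut_rep_eq:
  assumes X: "compact_space X" "Hausdorff_space X" and A: "A \<in> carrier (hAut X)" and f: "f \<in> A"
  shows "hAut_rep p n X A = Conf_homology_map p n X X f"
proof -
  have "Conf_homology_map p n X X g = Conf_homology_map p n X X f" if "g \<in> A" for g
  proof -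
    have "homotopic X X g f"
      using A f that unfolding hAut_def homotopy_class_def
      by (auto intro: homotopic_with_trans homotopic_with_symD)
    then show ?thesis
      using X by (intro Conf_homology_map_homotopic)
  qed
  then have "Conf_homology_map p n X X ` A = {Conf_homology_map p n X X f}"
    using f by blast
  then show ?thesis by (simp add: hAut_rep_def)
qed

lemma hAut_rep_class:
  assumes "compact_space X" "Hausdorff_space X" "homotopy_inverse X X f f'"
  shows "hAut_rep p n X (homotopy_class X X f) = Conf_homology_map p n X X f"
proof (rule hAut_rep_eq[OF assms(1,2) hAut_carrierI[OF assms(3)]])
  show "f \<in> homotopy_class X X f"
    using assms(3) by (simp add: homotopy_class_def homotopy_inverse_def)
qed

lemma group_hom_hAut_rep:
  assumes X: "compact_space X" "Hausdorff_space X"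
  shows "group_hom (hAut X) (AutoGroup (Conf_homology p n X)) (hAut_rep p n X)"
proof (rule group_hom_AutoGroupI)
  fix A assume "A \<in> carrier (hAut X)"
  then obtain f where "hAut_rep p n X A = Conf_homology_map p n X X f"
    using hAut_rep_class[OF X] by (metis hAut_carrierE)
  then show "hAut_rep p n X A \<in> hom (Conf_homology p n X) (Conf_homology p n X)"
    and "hAut_rep p n X A \<in> extensional (carrier (Conf_homology p n X))"
    using Conf_homology_map_hom by (auto simp: Conf_homology_map_def)
next
  show "hAut_rep p n X \<one>\<^bsub>hAut X\<^esub> = (\<lambda>c\<in>carrier (Conf_homology p n X). c)"
    using hAut_rep_class[OF X homotopy_inverse_id]
    by (simp add: hAut_one Conf_homology_map_id)
next
  fix A B assume "A \<in> carrier (hAut X)" "B \<in> carrier (hAut X)"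
  then obtain f f' g g' where f: "A = homotopy_class X X f" "homotopy_inverse X X f f'" "continuous_map X X f"
    and g: "B = homotopy_class X X g" "homotopy_inverse X X g g'" "continuous_map X X g"
    by (metis hAut_carrierE)
  then show "hAut_rep p n X (A \<otimes>\<^bsub>hAut X\<^esub> B)
      = compose (carrier (Conf_homology p n X)) (hAut_rep p n X A) (hAut_rep p n X B)"
    using X hAut_rep_class[OF X homotopy_inverse_compose[OF g(2) f(2)]]
    by (simp add: hAut_mult_class hAut_rep_class Conf_homology_map_compose)
qed (simp_all add: group_hAut)

lemma Conf_homology_map_inverse:
  assumes X: "compact_space X" "Hausdorff_space X" and Y: "compact_space Y" "Hausdorff_space Y"
    and m: "homotopy_inverse X Y m m'" and c: "c \<in> carrier (Conf_homology p n X)"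
  shows "Conf_homology_map p n Y X m' (Conf_homology_map p n X Y m c) = c"
proof -
  have "Conf_homology_map p n X X (m' \<circ> m) = Conf_homology_map p n X X id"
    using m X by (intro Conf_homology_map_homotopic) (auto simp: homotopy_inverse_def)
  moreover have "Conf_homology_map p n Y X m' (Conf_homology_map p n X Y m c)
      = Conf_homology_map p n X X (m' \<circ> m) c"
    using m c by (intro Conf_homology_map_compose_apply X Y) (auto simp: homotopy_inverse_def)
  ultimately show ?thesis
    using c by (simp add: Conf_homology_map_id)
qed

lemma Conf_homology_map_iso:
  assumes X: "compact_space X" "Hausdorff_space X" and Y: "compact_space Y" "Hausdorff_space Y"
    and m: "homotopy_inverse X Y m m'"
  shows "Conf_homology_map p n X Y m \<in> iso (Conf_homology p n X) (Conf_homology p n Y)"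
proof -
  have "bij_betw (Conf_homology_map p n X Y m) (carrier (Conf_homology p n X)) (carrier (Conf_homology p n Y))"
    using Conf_homology_map_inverse[OF X Y m] Conf_homology_map_inverse[OF Y X homotopy_inverse_sym[OF m]]
    by (intro bij_betw_byWitness[where f' = "Conf_homology_map p n Y X m'"])
      (auto simp: Conf_homology_map_mem)
  then show ?thesis
    by (simp add: iso_def Conf_homology_map_hom)
qed

text \<open>The two composites agree already on points, by \<open>Conf_plus_map_perm\<close>.\<close>

lemma Conf_homology_map_sym_equivariant:
  assumes X: "compact_space X" "Hausdorff_space X" and Y: "compact_space Y" "Hausdorff_space Y"
    and f: "continuous_map X Y f"
    and \<sigma>: "\<sigma> \<in> carrier (sym_group n)" and c: "c \<in> carrier (Conf_homology p n X)"
  shows "Conf_homology_map p n X Y f (sym_rep p n X \<sigma> c) = sym_rep p n Y \<sigma> (Conf_homology_map p n X Y f c)"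
proof -
  note perm = sym_group_carrier[THEN iffD1, OF \<sigma>]
  note cont = continuous_map_Conf_plus_map[OF X Y(2) f, of n]
    continuous_map_Conf_plus_perm[OF X perm] continuous_map_Conf_plus_perm[OF Y perm]
  note comp = hom_induced_compose_empty[OF cont(2) cont(1), of p, unfolded Conf_plus_map_perm[OF perm]]
    hom_induced_compose_empty[OF cont(1) cont(3), of p]
  show ?thesis
    using c fun_cong[OF trans[OF comp(1)[symmetric] comp(2)], of c]
    by (simp add: Conf_homology_map_def sym_rep_def hom_induced_mem)
qed

text \<open>If \<open>A = [f]\<close>, the two sides are induced by \<open>m \<circ> f\<close> and \<open>(m \<circ> f \<circ> m') \<circ> m\<close>, which are
  homotopic.\<close>

lemma Conf_homology_map_hAut_equivariant:
  assumes X: "compact_space X" "Hausdorff_space X" and Y: "compact_space Y" "Hausdorff_space Y"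
    and m: "homotopy_inverse X Y m m'"
    and A: "A \<in> carrier (hAut X)" and c: "c \<in> carrier (Conf_homology p n X)"
  shows "Conf_homology_map p n X Y m (hAut_rep p n X A c)
    = hAut_rep p n Y (hAut_map Y m m' A) (Conf_homology_map p n X Y m c)"
proof -
  obtain f f' where f: "A = homotopy_class X X f" "homotopy_inverse X X f f'" "continuous_map X X f"
    using A by (metis hAut_carrierE)
  have mc: "continuous_map X Y m" "continuous_map Y X m'"
    using m by (auto simp: homotopy_inverse_def)
  have conj: "continuous_map Y Y (m \<circ> f \<circ> m')"
    using f mc by (auto intro: continuous_map_compose)
  have "hAut_map Y m m' A = homotopy_class Y Y (m \<circ> f \<circ> m')"
    using f mc by (simp add: hAut_map_class)
  then have rep: "hAut_rep p n Y (hAut_map Y m m' A) = Conf_homology_map p n Y Y (m \<circ> f \<circ> m')"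
    using conj group_hom.hom_closed[OF group_hom_hAut_map[OF m] A]
    by (intro hAut_rep_eq Y) (auto simp: homotopy_class_def)
  have "homotopic X Y ((m \<circ> f) \<circ> m' \<circ> m \<circ> id) ((m \<circ> f) \<circ> id)"
    using m mc f by (intro homotopic_cancel) (auto simp: homotopy_inverse_def intro: continuous_map_compose)
  then have "Conf_homology_map p n X Y ((m \<circ> f \<circ> m') \<circ> m) = Conf_homology_map p n X Y (m \<circ> f)"
    using X Y by (intro Conf_homology_map_homotopic) simp_all
  moreover have "Conf_homology_map p n X Y m (hAut_rep p n X A c) = Conf_homology_map p n X Y (m \<circ> f) c"
    using f hAut_rep_class[OF X f(2), of p n] Conf_homology_map_compose_apply[OF X X Y(2) f(3) mc(1) c] by simp
  moreover have "hAut_rep p n Y (hAut_map Y m m' A) (Conf_homology_map p n X Y m c)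
      = Conf_homology_map p n X Y ((m \<circ> f \<circ> m') \<circ> m) c"
    using rep Conf_homology_map_compose_apply[OF X Y Y(2) mc(1) conj c] by simp
  ultimately show ?thesis by simp
qed

theorem proposition2p2:
  fixes X :: "'a topology" and Y :: "'b topology"
    and m :: "'a \<Rightarrow> 'b" and m' :: "'b \<Rightarrow> 'a" and n :: nat
  assumes "compact_space X" and "Hausdorff_space X"
    and "compact_space Y" and "Hausdorff_space Y"
    and "homotopy_inverse X Y m m'"
  shows
    \<comment> \<open>the induced homomorphism \<open>\<phi>\<close>\<close>
    "group_hom (hAut X) (hAut Y) (hAut_map Y m m') \<and>
     (\<forall>p :: int.
       \<comment> \<open>the actions on both sides\<close>
       group_hom (sym_group n) (AutoGroup (Conf_homology p n X)) (sym_rep p n X) \<and>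
       group_hom (sym_group n) (AutoGroup (Conf_homology p n Y)) (sym_rep p n Y) \<and>
       group_hom (hAut X) (AutoGroup (Conf_homology p n X)) (hAut_rep p n X) \<and>
       group_hom (hAut Y) (AutoGroup (Conf_homology p n Y)) (hAut_rep p n Y) \<and>
       (\<forall>A \<in> carrier (hAut X). \<forall>f \<in> A. hAut_rep p n X A = Conf_homology_map p n X X f) \<and>
       (\<forall>B \<in> carrier (hAut Y). \<forall>g \<in> B. hAut_rep p n Y B = Conf_homology_map p n Y Y g) \<and>
       \<comment> \<open>the induced map is an isomorphism of \<open>S\<^sub>n\<close>-representations\<close>
       Conf_homology_map p n X Y m \<in> iso (Conf_homology p n X) (Conf_homology p n Y) \<and>
       (\<forall>\<sigma> \<in> carrier (sym_group n). \<forall>c \<in> carrier (Conf_homology p n X).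
          Conf_homology_map p n X Y m (sym_rep p n X \<sigma> c)
            = sym_rep p n Y \<sigma> (Conf_homology_map p n X Y m c)) \<and>
       \<comment> \<open>it is equivariant for \<open>hAut X\<close>, which acts on the target through \<open>\<phi>\<close>\<close>
       (\<forall>A \<in> carrier (hAut X). \<forall>c \<in> carrier (Conf_homology p n X).
          Conf_homology_map p n X Y m (hAut_rep p n X A c)
            = hAut_rep p n Y (hAut_map Y m m' A) (Conf_homology_map p n X Y m c)))"
proof -
  note X = assms(1,2) and Y = assms(3,4) and m = assms(5)
  have mc: "continuous_map X Y m"
    using m by (simp add: homotopy_inverse_def)
  show ?thesis
    using group_hom_hAut_map[OF m] group_hom_sym_rep[OF X] group_hom_sym_rep[OF Y]
      group_hom_hAut_rep[OF X] group_hom_hAut_rep[OF Y] hAut_rep_eq[OF X] hAut_rep_eq[OF Y]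
      Conf_homology_map_iso[OF X Y m] Conf_homology_map_sym_equivariant[OF X Y mc]
      Conf_homology_map_hAut_equivariant[OF X Y m]
    by (intro conjI allI ballI)
qed

end
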